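(* Let $\mathcal X$ be an arbitrary set, let $\mathcal C=\{\nu_i:i\ge 1\}$ be a countable class of uniformly bounded conditional probability densities on $\mathbb R$ given $x\in\mathcal X$, with prior weights $w_\nu>0$, $\sum_{\nu\in\mathcal C}w_\nu=1$ (as specified in the context), and assume that the true distribution $\mu$ satisfies $\mu\in\mathcal C$. Let $\varrho$, $\bar\varrho$ and $\varrho^{\mathrm{static}}$ denote the dynamic, normalized dynamic and static MDL predictors, and let $H^2_{x_{<\infty}}(\cdot,\cdot)$ denote the cumulative expected squared Hellinger distance, all as defined in the context. Then for every input sequence $x_{<\infty}=(x_1,x_2,\ldots)\in\mathcal X^\infty$: \begin{align*} (i)\quad & H^2_{x_{<\infty}}(\mu,\bar\varrho)\le w_\mu^{-1}+\ln w_\mu^{-1},\\ (ii)\quad & H^2_{x_{<\infty}}(\bar\varrho,\varrho)\le 2w_\mu^{-1},\\ (iii)\quad & H^2_{x_{<\infty}}(\varrho,\varrho^{\mathrm{static}})\le 3w_\mu^{-1}. \end{align*}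
   Context: Setup. $\mathcal X$ is an arbitrary set. $\mathcal C=\{\nu_i:i\ge1\}$ is a countable class of models, each a function from $\mathcal X$ to probability densities (w.r.t. Lebesgue measure) on $\mathbb R$, and there is a constant $C>0$ such that $0\le\nu_i(y|x)\le C$ and $\int_{-\infty}^\infty\nu_i(y|x)\,dy=1$ for all $i\ge1$, $x\in\mathcal X$, $y\in\mathbb R$. Each $\nu\in\mathcal C$ has a prior weight $w_\nu>0$, with $\sum_{\nu\in\mathcal C}w_\nu=1$. Notation: $x_{1:n}=(x_1,\ldots,x_n)$, $x_{<n}=x_{1:n-1}$, and similarly for $y$. Each $\nu\in\mathcal C$ induces a density on $\mathbb R^n$ by $\nu(y_{1:n}|x_{1:n})=\prod_{t=1}^n\nu(y_t|x_t)$ (equal to $1$ for $n=0$), and its prediction is $\nu(y_n|x_{1:n},y_{<n})=\nu(y_n|x_n)$. Data: given the input sequence $x_1,x_2,\ldots$, the outputs $y_t$ are sampled independently, $y_t\sim\mu(\cdot|x_t)$, where $\mu$ is the true distribution. $\mathbf E$ denotes expectation with respect to $\mu$ (for the fixed input sequence). MDL estimator: $\nu^*_{(x_{1:n},y_{1:n})}=\arg\max_{\nu\in\mathcal C}\{w_\nu\nu(y_{1:n}|x_{1:n})\}$ (the maximum exists; ties are broken by a fixed measurable rule, e.g. smallest index), and $\varrho(y_{1:n}|x_{1:n})=\max_{\nu\in\mathcal C}\{w_\nu\nu(y_{1:n}|x_{1:n})\}$; for $n=0$, $\varrho(\emptyset)=\max_\nu w_\nu$. Predictors: - static MDL: $\varrho^{\mathrm{static}}(y_n|x_{1:n},y_{<n})=\nu^*_{(x_{<n},y_{<n})}(y_n|x_n)$;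 - dynamic MDL: $\varrho(y_n|x_{1:n},y_{<n})=\dfrac{\varrho(y_{1:n}|x_{1:n})}{\varrho(y_{<n}|x_{<n})}$ (not necessarily of total mass $1$); - normalized dynamic MDL: $\bar\varrho(y_n|x_{1:n},y_{<n})=\dfrac{\varrho(y_{1:n}|x_{1:n})}{\int\varrho(y_{1:n}|x_{1:n})\,dy_n}$. The fractions are well defined except on a set of $\mu$-measure zero of histories. Cumulative Hellinger distance: for predictors $\varphi,\psi$ (nonnegative functions $\varphi(y_t|x_{1:t},y_{<t})$, $\psi(y_t|x_{1:t},y_{<t})$), $$H^2_{x_{<\infty}}(\varphi,\psi)=\sum_{t=1}^\infty\mathbf E\int_{\mathbb R}\Big(\sqrt{\varphi(y_t|x_{1:t},y_{<t})}-\sqrt{\psi(y_t|x_{1:t},y_{<t})}\Big)^2dy_t,$$ where $\mathbf E$ is always with respect to $\mu$ (over $y_{<t}$). *)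

theory Defs
  imports "HOL-Probability.Probability"
begin

text \<open>
  Time is counted from 0: \<open>x t\<close> and \<open>y t\<close> are the \<open>(t + 1)\<close>-st input and output, and
  a quantity indexed by \<open>n\<close> reads only the first \<open>n\<close> entries of its history. A predictor at
  time \<open>n\<close> gets \<open>x 0, \<dots>, x n\<close> and \<open>y 0, \<dots>, y (n - 1)\<close>, and its last argument is the
  candidate value for \<open>y n\<close>.
\<close>

type_synonym 'x model = "'x \<Rightarrow> real \<Rightarrow> real"
type_synonym 'x predictor = "nat \<Rightarrow> (nat \<Rightarrow> 'x) \<Rightarrow> (nat \<Rightarrow> real) \<Rightarrow> real \<Rightarrow> real"

definition lik :: "'x model \<Rightarrow> nat \<Rightarrow> (nat \<Rightarrow> 'x) \<Rightarrow> (nat \<Rightarrow> real) \<Rightarrow> real" where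
  "lik \<nu> n x y = (\<Prod>t<n. \<nu> (x t) (y t))"

definition model_pred :: "'x model \<Rightarrow> 'x predictor" where
  "model_pred \<nu> n x y z = \<nu> (x n) z"

text \<open>The supremum in the next definition is a maximum, see \<open>mdl_argmax_nonempty\<close> below.\<close>

definition mdl :: "'x model set \<Rightarrow> ('x model \<Rightarrow> real) \<Rightarrow> nat \<Rightarrow> (nat \<Rightarrow> 'x) \<Rightarrow> (nat \<Rightarrow> real) \<Rightarrow> real" where
  "mdl C w n x y = (SUP \<nu>\<in>C. w \<nu> * lik \<nu> n x y)"

definition mdl_argmax ::
  "'x model set \<Rightarrow> ('x model \<Rightarrow> real) \<Rightarrow> nat \<Rightarrow> (nat \<Rightarrow> 'x) \<Rightarrow> (nat \<Rightarrow> real) \<Rightarrow> 'x model set" where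
  "mdl_argmax C w n x y = {\<nu> \<in> C. \<forall>\<nu>'\<in>C. w \<nu>' * lik \<nu>' n x y \<le> w \<nu> * lik \<nu> n x y}"

text \<open>
  An MDL estimator is the arg max together with an arbitrary measurable rule for breaking ties.
  The last clause says that the estimate is a function of the first \<open>n\<close> inputs and outputs only.
\<close>

definition mdl_estimator ::
  "'x model set \<Rightarrow> ('x model \<Rightarrow> real) \<Rightarrow> (nat \<Rightarrow> (nat \<Rightarrow> 'x) \<Rightarrow> (nat \<Rightarrow> real) \<Rightarrow> 'x model) \<Rightarrow> bool" where
  "mdl_estimator C w est \<longleftrightarrow>
     (\<forall>n x y. est n x y \<in> mdl_argmax C w n x y) \<and>
     (\<forall>n x. est n x \<in> measurable (PiM UNIV (\<lambda>_. borel)) (count_space C)) \<and>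
     (\<forall>n x x' y y'. (\<forall>t<n. x t = x' t \<and> y t = y' t) \<longrightarrow> est n x y = est n x' y')"

definition static_mdl ::
  "(nat \<Rightarrow> (nat \<Rightarrow> 'x) \<Rightarrow> (nat \<Rightarrow> real) \<Rightarrow> 'x model) \<Rightarrow> 'x predictor" where
  "static_mdl est n x y z = est n x y (x n) z"

text \<open>
  A vanishing denominator in the next two definitions yields the value 0. This concerns only
  histories that have probability 0 under the true distribution.
\<close>

definition dynamic_mdl :: "'x model set \<Rightarrow> ('x model \<Rightarrow> real) \<Rightarrow> 'x predictor" where
  "dynamic_mdl C w n x y z = mdl C w (Suc n) x (y(n := z)) / mdl C w n x y"

definition norm_dynamic_mdl :: "'x model set \<Rightarrow> ('x model \<Rightarrow> real) \<Rightarrow> 'x predictor" where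
  "norm_dynamic_mdl C w n x y z =
     mdl C w (Suc n) x (y(n := z)) / (\<integral>z'. mdl C w (Suc n) x (y(n := z')) \<partial>lborel)"

definition data_measure :: "'x model \<Rightarrow> (nat \<Rightarrow> 'x) \<Rightarrow> (nat \<Rightarrow> real) measure" where
  "data_measure \<mu> x = PiM UNIV (\<lambda>t. density lborel (\<lambda>y. ennreal (\<mu> (x t) y)))"

definition hellinger2 ::
  "'x model \<Rightarrow> (nat \<Rightarrow> 'x) \<Rightarrow> 'x predictor \<Rightarrow> 'x predictor \<Rightarrow> ennreal" where
  "hellinger2 \<mu> x \<phi> \<psi> =
     (\<Sum>t. \<integral>\<^sup>+y. (\<integral>\<^sup>+z. ennreal ((sqrt (\<phi> t x y z) - sqrt (\<psi> t x y z))\<^sup>2) \<partial>lborel) \<partial>data_measure \<mu> x)"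

lemma lik_cong:
  assumes "\<forall>t<n. x t = x' t \<and> y t = y' t"
  shows "lik \<nu> n x y = lik \<nu> n x' y'"
  unfolding lik_def using assms by (intro prod.cong) auto

lemma mdl_argmax_nonempty:
  fixes C :: "'x model set"
  assumes bound: "\<And>\<nu> x y. \<nu> \<in> C \<Longrightarrow> 0 \<le> \<nu> x y \<and> \<nu> x y \<le> B" and B: "B > 0"
    and w: "\<And>\<nu>. \<nu> \<in> C \<Longrightarrow> 0 < w \<nu>" and w1: "(w has_sum 1) C"
  shows "mdl_argmax C w n x y \<noteq> {}"
proof -
  define f where "f \<nu> = w \<nu> * lik \<nu> n x y" for \<nu>
  have ne: "C \<noteq> {}" using infsumI[OF w1] by auto
  have lik: "0 \<le> lik \<nu> n x y" "lik \<nu> n x y \<le> B ^ n" if "\<nu> \<in> C" for \<nu>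
  proof -
    show "0 \<le> lik \<nu> n x y" unfolding lik_def using bound[OF that] by (intro prod_nonneg) auto
    have "lik \<nu> n x y \<le> (\<Prod>t<n. B)" unfolding lik_def using bound[OF that] by (intro prod_mono) auto
    then show "lik \<nu> n x y \<le> B ^ n" by simp
  qed
  have "\<exists>\<nu>\<in>C. \<forall>\<nu>'\<in>C. f \<nu>' \<le> f \<nu>"
  proof (cases "\<exists>\<nu>\<in>C. f \<nu> > 0")
    case False
    obtain \<nu> where n: "\<nu> \<in> C" using ne by auto
    have "0 \<le> f \<nu>" unfolding f_def using lik(1)[OF n] w[OF n] by simp
    then show ?thesis using n False by force
  next
    case True
    then obtain \<nu>0 where \<nu>0: "\<nu>0 \<in> C" "f \<nu>0 > 0" by auto
    define S where "S = {\<nu> \<in> C. f \<nu>0 \<le> f \<nu>}"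
    define e where "e = f \<nu>0 / B ^ n"
    have e: "e > 0" using \<nu>0 B by (simp add: e_def)
    have we: "e \<le> w \<nu>" if "\<nu> \<in> S" for \<nu>
    proof -
      have "\<nu> \<in> C" "f \<nu>0 \<le> w \<nu> * lik \<nu> n x y" using that by (auto simp: S_def f_def)
      moreover have "w \<nu> * lik \<nu> n x y \<le> w \<nu> * B ^ n"
        using w[OF \<open>\<nu> \<in> C\<close>] lik(2)[OF \<open>\<nu> \<in> C\<close>] by (intro mult_left_mono) auto
      ultimately show ?thesis using B by (simp add: e_def field_simps)
    qed
    have "finite S"
    proof (rule ccontr)
      assume inf: "infinite S"
      obtain k :: nat where k: "1 < real k * e" using reals_Archimedean3[OF e] by blast
      obtain F where F: "finite F" "card F = k" "F \<subseteq> S"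
        using infinite_arbitrarily_large[OF inf] by blast
      have "real k * e \<le> sum w F" using sum_bounded_below[of F e w] we F by auto
      also have "\<dots> \<le> 1"
      proof (rule has_sum_mono2[OF has_sum_finite[OF F(1)] w1])
        show "F \<subseteq> C" using F S_def by auto
        show "\<And>\<nu>. \<nu> \<in> C - F \<Longrightarrow> 0 \<le> w \<nu>" using w by (simp add: less_imp_le)
      qed
      finally show False using k by simp
    qed
    moreover have "\<nu>0 \<in> S" using \<nu>0 by (simp add: S_def)
    ultimately obtain \<nu> where \<nu>: "\<nu> \<in> S" "\<forall>\<nu>'\<in>S. f \<nu>' \<le> f \<nu>"
      using Max_in[of "f ` S"] Max_ge[of "f ` S"]
      by (metis (no_types, lifting) empty_iff finite_imageI imageE image_eqI image_is_empty)
    then have "\<forall>\<nu>'\<in>C. f \<nu>' \<le> f \<nu>" unfolding S_def by force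
    then show ?thesis using \<nu> S_def by auto
  qed
  then show ?thesis unfolding mdl_argmax_def f_def by auto
qed

lemma mdl_estimator_exists:
  fixes C :: "'x model set"
  assumes C: "countable C"
    and meas: "\<And>\<nu> x. \<nu> \<in> C \<Longrightarrow> \<nu> x \<in> borel_measurable borel"
    and bound: "\<And>\<nu> x y. \<nu> \<in> C \<Longrightarrow> 0 \<le> \<nu> x y \<and> \<nu> x y \<le> B" and B: "B > 0"
    and w: "\<And>\<nu>. \<nu> \<in> C \<Longrightarrow> 0 < w \<nu>" and w1: "(w has_sum 1) C"
  shows "\<exists>est. mdl_estimator C w est"
proof -
  define est where "est n x y = from_nat_into C (LEAST i. from_nat_into C i \<in> mdl_argmax C w n x y)"
    for n x y
  have ne: "C \<noteq> {}" using infsumI[OF w1] by auto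
  have 1: "est n x y \<in> mdl_argmax C w n x y" for n x y
  proof -
    obtain \<nu> where \<nu>: "\<nu> \<in> mdl_argmax C w n x y"
      using mdl_argmax_nonempty[of C B w n x y] bound B w w1 by blast
    then have "\<nu> \<in> C" by (simp add: mdl_argmax_def)
    then have "from_nat_into C (to_nat_on C \<nu>) \<in> mdl_argmax C w n x y" using \<nu> C by simp
    then show ?thesis unfolding est_def by (rule LeastI)
  qed
  have 2: "est n x \<in> measurable (PiM UNIV (\<lambda>_. borel)) (count_space C)" for n x
  proof -
    have l: "(\<lambda>y. lik \<nu> n x y) \<in> borel_measurable (PiM UNIV (\<lambda>_. borel))" if "\<nu> \<in> C" for \<nu>
    proof -
      have "(\<lambda>y. \<nu> (x t) (y t)) \<in> borel_measurable (PiM UNIV (\<lambda>_. borel))" for t :: nat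
      proof (rule measurable_compose[where g = "\<nu> (x t)" and N = borel])
        show "(\<lambda>y. y t) \<in> measurable (PiM UNIV (\<lambda>_. borel)) borel" by measurable
        show "\<nu> (x t) \<in> borel_measurable borel" using that by (rule meas)
      qed
      then show ?thesis unfolding lik_def by (intro borel_measurable_prod)
    qed
    have p: "Measurable.pred (PiM UNIV (\<lambda>_. borel)) (\<lambda>y. from_nat_into C i \<in> mdl_argmax C w n x y)" for i
    proof -
      have fi: "from_nat_into C i \<in> C" using ne by (rule from_nat_into)
      have "(\<lambda>y. from_nat_into C i \<in> mdl_argmax C w n x y) =
        (\<lambda>y. \<forall>k. w (from_nat_into C k) * lik (from_nat_into C k) n x y \<le> w (from_nat_into C i) * lik (from_nat_into C i) n x y)"
        using fi from_nat_into[OF ne] from_nat_into_surj[OF C] unfolding mdl_argmax_def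
        by (intro ext) (simp, metis)
      moreover have "Measurable.pred (PiM UNIV (\<lambda>_. borel)) \<dots>"
      proof -
        have "(\<lambda>y. w (from_nat_into C k) * lik (from_nat_into C k) n x y)
            \<in> borel_measurable (PiM UNIV (\<lambda>_. borel))" for k
          using ne by (intro borel_measurable_times borel_measurable_const l from_nat_into)
        then show ?thesis
          by (intro pred_intros_countable) (unfold pred_def, intro borel_measurable_le)
      qed
      ultimately show ?thesis by simp
    qed
    show ?thesis unfolding est_def
      by (rule measurable_compose[OF measurable_Least[OF p]]) (use ne in \<open>auto intro: from_nat_into\<close>)
  qed
  have 3: "est n x y = est n x' y'" if "\<forall>t<n. x t = x' t \<and> y t = y' t" for n x x' y y'
    unfolding est_def mdl_argmax_def using lik_cong[OF that] by simp
  show ?thesis unfolding mdl_estimator_def using 1 2 3 by blast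
qed

end

theory Submission
  imports Defs
begin

text \<open>
  Write \<open>M\<^sub>n\<close> for the maximum \<open>mdl C w n\<close>, \<open>N\<^sub>n\<close> for the integral of \<open>M\<^sub>n\<^sub>+\<^sub>1\<close> over its last
  output, \<open>L\<^sub>n\<close> for the likelihood under \<open>\<mu>\<close> and \<open>\<xi>\<^sub>n\<close> for the mixture with weights \<open>w\<close>. Then
  \<open>w \<mu> * L\<^sub>n \<le> M\<^sub>n \<le> N\<^sub>n \<le> \<xi>\<^sub>n\<close>, and \<open>\<xi>\<^sub>n\<close> keeps its mass when an output is integrated out. Hence
  the expectation of \<open>(\<xi>\<^sub>n - M\<^sub>n) / L\<^sub>n\<close>, which is at most 1 for \<open>n = 0\<close>, drops in each step by at
  least the expectation of \<open>(N\<^sub>n - M\<^sub>n) / L\<^sub>n\<close>, so the expectations of the relative gains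
  \<open>(N\<^sub>n - M\<^sub>n) / M\<^sub>n\<close> sum to at most \<open>1 / w \<mu>\<close>.

  The squared distances of the dynamic predictor \<open>M\<^sub>n\<^sub>+\<^sub>1 / M\<^sub>n\<close> to its normalization and to the
  static predictor, which it dominates, are at most the relative gain for every history; this
  gives (ii) and (iii) even with the bound \<open>1 / w \<mu>\<close>. For (i), the squared Hellinger distance of
  densities \<open>p\<close> and \<open>q\<close> is twice the expectation of \<open>1 - \<surd>(q / p)\<close> under \<open>p\<close>, and
  \<open>2 * (1 - \<surd>(q / p)) \<le> ln (p / q)\<close>. For \<open>q = M\<^sub>n\<^sub>+\<^sub>1 / N\<^sub>n\<close> these logarithms telescope up to the terms
  \<open>ln (N\<^sub>n / M\<^sub>n)\<close>, which are again bounded by the relative gain.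
\<close>

text \<open>Bounds a squared difference of roots by a plain difference, which can be integrated
  exactly. It is applied to the masses \<open>M n y\<close> and \<open>next_mass n y\<close>, and
  pointwise to the dynamic and static predictors.\<close>

lemma sqrt_diff_square_le:
  fixes a b :: real
  assumes "0 \<le> b" "b \<le> a"
  shows "(sqrt a - sqrt b)\<^sup>2 \<le> a - b"
proof -
  have "a - b - (sqrt a - sqrt b)\<^sup>2 = 2 * sqrt b * (sqrt a - sqrt b)"
    using assms by (simp add: power2_diff algebra_simps)
  also have "\<dots> \<ge> 0" using assms by simp
  finally show ?thesis by simp
qed

section \<open>Setting: the model class and a fixed input sequence\<close>

locale mdl_class =
  fixes C :: "'x model set" and w :: "'x model \<Rightarrow> real" and B :: real
    and \<mu> :: "'x model" and x :: "nat \<Rightarrow> 'x"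
  assumes countable_C: "countable C"
    and B_pos: "B > 0"
    and model_measurable: "\<And>\<nu> a. \<nu> \<in> C \<Longrightarrow> \<nu> a \<in> borel_measurable borel"
    and model_bounds: "\<And>\<nu> a b. \<nu> \<in> C \<Longrightarrow> 0 \<le> \<nu> a b \<and> \<nu> a b \<le> B"
    and model_integral: "\<And>\<nu> a. \<nu> \<in> C \<Longrightarrow> (\<integral>b. \<nu> a b \<partial>lborel) = 1"
    and w_pos: "\<And>\<nu>. \<nu> \<in> C \<Longrightarrow> w \<nu> > 0"
    and w_sum: "(w has_sum 1) C"
    and true_model: "\<mu> \<in> C"
begin

abbreviation "Y \<equiv> PiM (UNIV :: nat set) (\<lambda>_. borel :: real measure)"
abbreviation "D \<equiv> data_measure \<mu> x"
abbreviation "M n y \<equiv> mdl C w n x y"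
abbreviation "L n y \<equiv> lik \<mu> n x y"

definition next_mass :: "nat \<Rightarrow> (nat \<Rightarrow> real) \<Rightarrow> real" where
  "next_mass n y = (\<integral>z. M (Suc n) (y(n := z)) \<partial>lborel)"

text \<open>The Bayes mixture, written as a nonnegative integral over \<open>count_space C\<close>
  so that Tonelli applies directly; it is finite by \<open>mixture_le\<close>.\<close>

definition mixture :: "nat \<Rightarrow> (nat \<Rightarrow> real) \<Rightarrow> ennreal" where
  "mixture n y = (\<integral>\<^sup>+\<nu>. ennreal (w \<nu> * lik \<nu> n x y) \<partial>count_space C)"

section \<open>Models, weights and likelihoods\<close>

lemma nn_integral_model:
  assumes "\<nu> \<in> C" shows "(\<integral>\<^sup>+b. ennreal (\<nu> a b) \<partial>lborel) = 1"
proof -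
  \<comment> \<open>A non-integrable function has Bochner integral 0, so the value 1 forces
    integrability.\<close>
  have "integrable lborel (\<nu> a)"
    using model_integral[OF assms, of a] not_integrable_integral_eq by fastforce
  then show ?thesis
    using model_integral[OF assms, of a] model_bounds[OF assms]
    by (subst nn_integral_eq_integral) auto
qed

lemma measurable_true [measurable]: "\<mu> a \<in> borel_measurable borel"
  using true_model by (rule model_measurable)

lemma w_le_1: "\<nu> \<in> C \<Longrightarrow> w \<nu> \<le> 1"
proof -
  assume "\<nu> \<in> C"
  have "sum w {\<nu>} \<le> 1"
    by (rule has_sum_mono2[OF has_sum_finite w_sum])
      (use \<open>\<nu> \<in> C\<close> w_pos in \<open>auto simp: less_imp_le\<close>)
  then show ?thesis by simp
qed

lemma w_true: "0 < w \<mu>" using true_model by (rule w_pos)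

lemma nn_integral_w: "(\<integral>\<^sup>+\<nu>. ennreal (w \<nu>) \<partial>count_space C) = 1"
proof -
  have "w summable_on C" using w_sum by (rule has_sum_imp_summable)
  then have s: "Infinite_Set_Sum.abs_summable_on w C"
    using abs_summable_equivalent summable_on_iff_abs_summable_on_real by blast
  have "infsetsum w C = 1"
    by (rule trans[OF infsetsum_infsum[OF s] infsumI[OF w_sum]])
  then show ?thesis
    using nn_integral_conv_infsetsum[OF s] w_pos by (simp add: less_imp_le)
qed

lemma lik_nonneg: "\<nu> \<in> C \<Longrightarrow> 0 \<le> lik \<nu> n x y"
  unfolding lik_def using model_bounds by (intro prod_nonneg) auto

lemma lik_le: "\<nu> \<in> C \<Longrightarrow> lik \<nu> n x y \<le> B ^ n"
proof -
  assume "\<nu> \<in> C"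
  then have "lik \<nu> n x y \<le> (\<Prod>t<n. B)"
    unfolding lik_def using model_bounds by (intro prod_mono) auto
  then show ?thesis by simp
qed

lemma lik_Suc: "lik \<nu> (Suc n) x y = lik \<nu> n x y * \<nu> (x n) (y n)"
  by (simp add: lik_def)

lemma lik_upd [simp]: "lik \<nu> n x (y(n := z)) = lik \<nu> n x y"
  by (rule lik_cong) auto

lemma next_mass_upd [simp]: "next_mass n (y(n := z)) = next_mass n y"
  by (simp add: next_mass_def)

section \<open>The maximum and the mixture\<close>

lemma mdl_bdd: "bdd_above ((\<lambda>\<nu>. w \<nu> * lik \<nu> n x y) ` C)"
proof (rule bdd_aboveI2)
  fix \<nu> assume "\<nu> \<in> C"
  then show "w \<nu> * lik \<nu> n x y \<le> 1 * B ^ n"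
    using w_le_1 w_pos lik_le lik_nonneg by (intro mult_mono) (auto simp: less_imp_le)
qed

lemma mdl_ge: "\<nu> \<in> C \<Longrightarrow> w \<nu> * lik \<nu> n x y \<le> M n y"
  unfolding mdl_def by (rule cSUP_upper[OF _ mdl_bdd])

lemma mdl_eq_argmax:
  assumes "\<nu> \<in> mdl_argmax C w n x y" shows "M n y = w \<nu> * lik \<nu> n x y"
proof (rule antisym)
  show "M n y \<le> w \<nu> * lik \<nu> n x y"
    unfolding mdl_def using assms true_model by (intro cSUP_least) (auto simp: mdl_argmax_def)
  show "w \<nu> * lik \<nu> n x y \<le> M n y"
    using assms by (intro mdl_ge) (auto simp: mdl_argmax_def)
qed

lemma mdl_attained: obtains \<nu> where "\<nu> \<in> C" "M n y = w \<nu> * lik \<nu> n x y"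
proof -
  obtain \<nu> where "\<nu> \<in> mdl_argmax C w n x y"
    using mdl_argmax_nonempty[of C B w n x y] model_bounds B_pos w_pos w_sum by blast
  then show ?thesis
    using that mdl_eq_argmax by (auto simp: mdl_argmax_def)
qed

lemma mdl_nonneg: "0 \<le> M n y"
  using mdl_ge[OF true_model, of n y] lik_nonneg[OF true_model, of n y] w_true
  by (meson less_imp_le mult_nonneg_nonneg order_trans)

lemma mdl_0_le: "M 0 y \<le> 1"
  unfolding mdl_def lik_def using true_model w_le_1 by (intro cSUP_least) auto

text \<open>The maximum is attained, so it is one of the nonnegative summands of the
  mixture.\<close>

lemma mdl_le_mixture: "ennreal (M n y) \<le> mixture n y"
proof -
  obtain \<nu> where \<nu>: "\<nu> \<in> C" "M n y = w \<nu> * lik \<nu> n x y" by (rule mdl_attained)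
  show ?thesis
    unfolding \<nu>(2) mixture_def
    by (rule nn_integral_ge_point[OF \<nu>(1), of "\<lambda>\<nu>. ennreal (w \<nu> * lik \<nu> n x y)"])
qed

lemma mixture_le: "mixture n y \<le> ennreal (B ^ n)"
proof -
  have "mixture n y \<le> (\<integral>\<^sup>+\<nu>. ennreal (w \<nu>) * ennreal (B ^ n) \<partial>count_space C)"
    unfolding mixture_def
    by (intro nn_integral_mono) (use lik_le w_pos B_pos in
      \<open>auto simp: ennreal_mult[symmetric] less_imp_le intro!: ennreal_leI mult_left_mono\<close>)
  also have "\<dots> = ennreal (B ^ n)"
    by (simp add: nn_integral_multc nn_integral_w)
  finally show ?thesis .
qed

lemma mixture_finite: "mixture n y < top"
  using mixture_le[of n y] by (rule le_less_trans) simp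

section \<open>Measurability in the outputs\<close>

lemma measurable_lik [measurable]: "\<nu> \<in> C \<Longrightarrow> lik \<nu> n x \<in> borel_measurable Y"
proof -
  assume "\<nu> \<in> C"
  note [measurable] = model_measurable[OF this]
  have "(\<lambda>y. \<nu> (x t) (y t)) \<in> borel_measurable Y" for t
    by (rule measurable_compose[where g = "\<nu> (x t)" and N = borel]) measurable
  then show ?thesis
    unfolding lik_def[abs_def] by (intro borel_measurable_prod)
qed

lemma measurable_L [measurable]: "lik \<mu> n x \<in> borel_measurable Y"
  using true_model by (rule measurable_lik)

lemma measurable_mdl [measurable]: "mdl C w n x \<in> borel_measurable Y"
  unfolding mdl_def[abs_def]
  by (intro borel_measurable_cSUP countable_C mdl_bdd) measurable

lemma measurable_mixture [measurable]: "mixture n \<in> borel_measurable Y"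
proof -
  interpret sigma_finite_measure "count_space C"
    using countable_C by (rule sigma_finite_measure_count_space_countable)
  \<comment> \<open>Since \<open>C\<close> is countable, joint measurability follows from
    measurability in \<open>y\<close> for each fixed model.\<close>
  have "(\<lambda>(\<nu>, y). ennreal (w \<nu> * lik \<nu> n x y)) \<in> borel_measurable (count_space C \<Otimes>\<^sub>M Y)"
    by (rule measurable_pair_measure_countable1[OF countable_C]) simp
  then have "(\<lambda>(y, \<nu>). ennreal (w \<nu> * lik \<nu> n x y)) \<in> borel_measurable (Y \<Otimes>\<^sub>M count_space C)"
    by (subst measurable_pair_swap_iff) simp
  then show ?thesis
    unfolding mixture_def[abs_def] by (rule borel_measurable_nn_integral)
qed

lemma measurable_upd [measurable]: "(\<lambda>(y, z). y(n := z)) \<in> measurable (Y \<Otimes>\<^sub>M borel) Y"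
  using measurable_add_dim[of n UNIV "\<lambda>_. borel :: real measure"] by simp

lemma measurable_next_mass [measurable]: "next_mass n \<in> borel_measurable Y"
proof -
  have "(\<lambda>(y, z). M (Suc n) (y(n := z))) \<in> borel_measurable (Y \<Otimes>\<^sub>M lborel)"
    by measurable
  then show ?thesis
    unfolding next_mass_def[abs_def] by (rule lborel.borel_measurable_lebesgue_integral)
qed

section \<open>The data measure\<close>

lemma sets_data [measurable_cong]: "sets D = sets Y"
  by (auto simp: data_measure_def intro!: sets_PiM_cong)

lemma prob_space_model: "prob_space (density lborel (\<lambda>b. ennreal (\<mu> a b)))"
  by (rule prob_spaceI) (simp add: emeasure_density nn_integral_model[OF true_model])

lemma prob_space_data: "prob_space D"
  unfolding data_measure_def by (intro prob_space_PiM prob_space_model)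

text \<open>The outputs are independent, so redrawing output \<open>n\<close> from its own factor
  leaves \<open>D\<close> unchanged. This makes the density of that output explicit under Lebesgue
  measure.\<close>

lemma nn_integral_data_upd:
  assumes f [measurable]: "f \<in> borel_measurable Y"
  shows "(\<integral>\<^sup>+y. f y \<partial>D) = (\<integral>\<^sup>+y. (\<integral>\<^sup>+z. ennreal (\<mu> (x n) z) * f (y(n := z)) \<partial>lborel) \<partial>D)"
proof -
  let ?P = "density lborel (\<lambda>b. ennreal (\<mu> (x n) b))"
  interpret P: prob_space ?P by (rule prob_space_model)
  interpret D: prob_space D by (rule prob_space_data)
  interpret PD: pair_sigma_finite ?P D ..
  \<comment> \<open>The general fact adjoins a coordinate to the index set; here
    \<open>insert n UNIV = UNIV\<close>, so entry \<open>n\<close> is overwritten instead.\<close>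
  have D_eq: "distr (?P \<Otimes>\<^sub>M D) D (\<lambda>(z, y). y(n := z)) = D"
    using distr_pair_PiM_eq_PiM[of UNIV "\<lambda>t. density lborel (\<lambda>y. ennreal (\<mu> (x t) y))" n]
    by (simp add: prob_space_model data_measure_def)
  have fD [measurable]: "f \<in> borel_measurable D"
    using f by simp
  have upd [measurable]: "(\<lambda>(z, y). y(n := z)) \<in> measurable (?P \<Otimes>\<^sub>M D) D"
    by measurable
  have "(\<integral>\<^sup>+y. f y \<partial>D) = (\<integral>\<^sup>+p. f ((\<lambda>(z, y). y(n := z)) p) \<partial>(?P \<Otimes>\<^sub>M D))"
    by (subst D_eq[symmetric], rule nn_integral_distr) measurable
  also have "\<dots> = (\<integral>\<^sup>+y. \<integral>\<^sup>+z. f (y(n := z)) \<partial>?P \<partial>D)"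
    by (subst PD.nn_integral_snd[symmetric]) (auto simp: case_prod_beta)
  also have "\<dots> = (\<integral>\<^sup>+y. (\<integral>\<^sup>+z. ennreal (\<mu> (x n) z) * f (y(n := z)) \<partial>lborel) \<partial>D)"
    by (intro nn_integral_cong nn_integral_density) simp_all
  finally show ?thesis .
qed

text \<open>A density vanishes only on a null set of its own measure, and there are countably many
  times. Almost surely, therefore, no division by a zero likelihood occurs.\<close>

lemma AE_lik_pos: "AE y in D. \<forall>n. 0 < L n y"
proof -
  have "AE y in D. 0 < \<mu> (x t) (y t)" for t
    unfolding data_measure_def
    by (rule AE_PiM_component[where P = "\<lambda>b. 0 < \<mu> (x t) b"])
      (auto simp: prob_space_model AE_density)
  then have "AE y in D. \<forall>t. 0 < \<mu> (x t) (y t)" by (simp add: AE_all_countable)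
  then show ?thesis by eventually_elim (auto simp: lik_def intro!: prod_pos)
qed

section \<open>Integrating out the last output\<close>

text \<open>By Tonelli the integral may be taken model by model, and each next density has mass
  1.\<close>

lemma nn_integral_mixture: "(\<integral>\<^sup>+z. mixture (Suc n) (y(n := z)) \<partial>lborel) = mixture n y"
proof -
  have "(\<integral>\<^sup>+z. mixture (Suc n) (y(n := z)) \<partial>lborel) =
    (\<integral>\<^sup>+\<nu>. \<integral>\<^sup>+z. ennreal (w \<nu> * lik \<nu> (Suc n) x (y(n := z))) \<partial>lborel \<partial>count_space C)"
    unfolding mixture_def
    by (rule nn_integral_count_space_nn_integral[OF countable_C])
      (simp add: lik_Suc, intro measurable_compose[OF _ measurable_ennreal] borel_measurable_times
        borel_measurable_const model_measurable)
  also have "\<dots> = mixture n y"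
    unfolding mixture_def
  proof (rule nn_integral_cong)
    fix \<nu> assume "\<nu> \<in> space (count_space C)"
    then have \<nu>: "\<nu> \<in> C" by simp
    note [measurable] = model_measurable[OF \<nu>]
    have "(\<integral>\<^sup>+z. ennreal (w \<nu> * lik \<nu> (Suc n) x (y(n := z))) \<partial>lborel) =
      (\<integral>\<^sup>+z. ennreal (w \<nu> * lik \<nu> n x y) * ennreal (\<nu> (x n) z) \<partial>lborel)"
      using w_pos[OF \<nu>] lik_nonneg[OF \<nu>, of n y] model_bounds[OF \<nu>]
      by (simp add: lik_Suc ennreal_mult[symmetric] mult.assoc less_imp_le)
    also have "\<dots> = ennreal (w \<nu> * lik \<nu> n x y)"
      by (simp add: nn_integral_cmult nn_integral_model[OF \<nu>])
    finally show "(\<integral>\<^sup>+z. ennreal (w \<nu> * lik \<nu> (Suc n) x (y(n := z))) \<partial>lborel) =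
      ennreal (w \<nu> * lik \<nu> n x y)" .
  qed
  finally show ?thesis .
qed

lemma measurable_upd_y [measurable]: "(\<lambda>z. y(n := z)) \<in> measurable borel Y"
proof -
  have "y \<in> space Y" by (simp add: space_PiM)
  then show ?thesis using measurable_Pair2[OF measurable_upd, of y n] by simp
qed

text \<open>Domination by the finite mixture makes the maximum integrable in its last output, so
  \<open>next_mass\<close> is a genuine integral and not the default value 0.\<close>

lemma nn_integral_mdl_Suc:
  "(\<integral>\<^sup>+z. ennreal (M (Suc n) (y(n := z))) \<partial>lborel) = ennreal (next_mass n y)"
  and next_mass_le_mixture: "ennreal (next_mass n y) \<le> mixture n y"
  and integrable_mdl_Suc: "integrable lborel (\<lambda>z. M (Suc n) (y(n := z)))"
proof -
  have le: "(\<integral>\<^sup>+z. ennreal (M (Suc n) (y(n := z))) \<partial>lborel) \<le> mixture n y"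
    by (subst nn_integral_mixture[symmetric]) (intro nn_integral_mono mdl_le_mixture)
  show int: "integrable lborel (\<lambda>z. M (Suc n) (y(n := z)))"
    by (rule integrableI_nonneg)
      (use le mixture_finite[of n y] in \<open>auto simp: mdl_nonneg intro: le_less_trans\<close>)
  show eq: "(\<integral>\<^sup>+z. ennreal (M (Suc n) (y(n := z))) \<partial>lborel) = ennreal (next_mass n y)"
    unfolding next_mass_def by (rule nn_integral_eq_integral[OF int]) (simp add: mdl_nonneg)
  show "ennreal (next_mass n y) \<le> mixture n y"
    using le eq by simp
qed

lemma next_mass_nonneg: "0 \<le> next_mass n y"
  unfolding next_mass_def by (rule Bochner_Integration.integral_nonneg) (rule mdl_nonneg)

text \<open>The model attaining the maximum at time \<open>n\<close> is still a candidate one step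
  later, and integrating its next density over \<open>z\<close> gives back its old value.\<close>

lemma mdl_le_next_mass: "M n y \<le> next_mass n y"
proof -
  obtain \<nu> where \<nu>: "\<nu> \<in> C" "M n y = w \<nu> * lik \<nu> n x y" by (rule mdl_attained)
  note [measurable] = model_measurable[OF \<nu>(1)]
  have int: "integrable lborel (\<nu> (x n))"
    using model_integral[OF \<nu>(1), of "x n"] not_integrable_integral_eq by fastforce
  have "M n y = (\<integral>z. w \<nu> * lik \<nu> n x y * \<nu> (x n) z \<partial>lborel)"
    using \<nu> model_integral[OF \<nu>(1)] by simp
  also have "\<dots> \<le> next_mass n y"
    unfolding next_mass_def
  proof (rule integral_mono[OF _ integrable_mdl_Suc])
    show "integrable lborel (\<lambda>z. w \<nu> * lik \<nu> n x y * \<nu> (x n) z)" using int by simp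
    show "w \<nu> * lik \<nu> n x y * \<nu> (x n) z \<le> M (Suc n) (y(n := z))" for z
      using mdl_ge[OF \<nu>(1), of "Suc n" "y(n := z)"] by (simp add: lik_Suc mult.assoc)
  qed
  finally show ?thesis .
qed

section \<open>The potential and the total relative gain\<close>

text \<open>The potential of the argument. Dividing by the likelihood turns the expectation into a
  Lebesgue integral over the outputs of positive likelihood. The subtraction is not truncated, by
  \<open>mdl_le_mixture\<close>.\<close>

definition slack :: "nat \<Rightarrow> ennreal" where
  "slack n = (\<integral>\<^sup>+y. ennreal (1 / L n y) * (mixture n y - ennreal (M n y)) \<partial>D)"

text \<open>Only an inequality: outputs with \<open>\<mu>\<close>-density 0 carry mass of the gap that is lost under \<open>D\<close>.\<close>

lemma slack_Suc:
  "slack (Suc n) + (\<integral>\<^sup>+y. ennreal ((next_mass n y - M n y) / L n y) \<partial>D) \<le> slack n"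
proof -
  let ?gap = "\<lambda>n y. mixture n y - ennreal (M n y)"
  have gap: "(\<integral>\<^sup>+z. ?gap (Suc n) (y(n := z)) \<partial>lborel) = mixture n y - ennreal (next_mass n y)" for y
    by (subst nn_integral_diff)
      (auto simp: mdl_le_mixture nn_integral_mixture nn_integral_mdl_Suc)
  have "slack (Suc n) = (\<integral>\<^sup>+y. (\<integral>\<^sup>+z. ennreal (\<mu> (x n) z) *
      (ennreal (1 / L (Suc n) (y(n := z))) * ?gap (Suc n) (y(n := z))) \<partial>lborel) \<partial>D)"
    unfolding slack_def by (rule nn_integral_data_upd) measurable
  also have "\<dots> \<le> (\<integral>\<^sup>+y. (\<integral>\<^sup>+z. ennreal (1 / L n y) * ?gap (Suc n) (y(n := z)) \<partial>lborel) \<partial>D)"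
  proof (intro nn_integral_mono)
    fix y z
    \<comment> \<open>Equality if \<open>\<mu> (x n) z > 0\<close>; otherwise the left side is
      0.\<close>
    have "\<mu> (x n) z * (1 / L (Suc n) (y(n := z))) \<le> 1 / L n y"
      using lik_nonneg[OF true_model, of n y] by (simp add: lik_Suc)
    then have "ennreal (\<mu> (x n) z) * ennreal (1 / L (Suc n) (y(n := z))) \<le> ennreal (1 / L n y)"
      using model_bounds[OF true_model] lik_nonneg[OF true_model, of "Suc n" "y(n := z)"]
      by (subst ennreal_mult[symmetric]) (auto intro!: ennreal_leI simp del: mult_1_right)
    then show "ennreal (\<mu> (x n) z) * (ennreal (1 / L (Suc n) (y(n := z))) * ?gap (Suc n) (y(n := z)))
        \<le> ennreal (1 / L n y) * ?gap (Suc n) (y(n := z))"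
      by (simp add: mult.assoc[symmetric] mult_right_mono)
  qed
  also have "\<dots> = (\<integral>\<^sup>+y. ennreal (1 / L n y) * (mixture n y - ennreal (next_mass n y)) \<partial>D)"
    by (simp add: nn_integral_cmult gap)
  finally have "slack (Suc n) + (\<integral>\<^sup>+y. ennreal ((next_mass n y - M n y) / L n y) \<partial>D)
    \<le> (\<integral>\<^sup>+y. ennreal (1 / L n y) * (mixture n y - ennreal (next_mass n y)) \<partial>D)
      + (\<integral>\<^sup>+y. ennreal ((next_mass n y - M n y) / L n y) \<partial>D)"
    by (rule add_right_mono)
  also have "\<dots> = (\<integral>\<^sup>+y. ennreal (1 / L n y) * (mixture n y - ennreal (next_mass n y))
      + ennreal ((next_mass n y - M n y) / L n y) \<partial>D)"
    by (rule nn_integral_add[symmetric]) measurable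
  also have "\<dots> = slack n"
    unfolding slack_def
  proof (rule nn_integral_cong)
    fix y
    \<comment> \<open>With the mixture a real number \<open>r\<close>, the identity is the splitting
      of \<open>r - M n y\<close> at \<open>next_mass n y\<close>.\<close>
    obtain r where r: "0 \<le> r" "mixture n y = ennreal r"
      using mixture_finite[of n y] by (cases "mixture n y") auto
    have "next_mass n y \<le> r"
      using next_mass_le_mixture[of n y] r by simp
    then have "ennreal ((r - M n y) / L n y)
        = ennreal ((r - next_mass n y) / L n y) + ennreal ((next_mass n y - M n y) / L n y)"
      using mdl_le_next_mass[of n y] lik_nonneg[OF true_model, of n y]
      by (subst ennreal_plus[symmetric]) (auto simp: add_divide_distrib[symmetric])
    moreover have "ennreal (1 / L n y) * (ennreal r - ennreal a) = ennreal ((r - a) / L n y)"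
      if "0 \<le> a" for a
      using that lik_nonneg[OF true_model, of n y] by (simp add: ennreal_minus ennreal_mult'[symmetric])
    ultimately show "ennreal (1 / L n y) * (mixture n y - ennreal (next_mass n y))
        + ennreal ((next_mass n y - M n y) / L n y)
      = ennreal (1 / L n y) * (mixture n y - ennreal (M n y))"
      using r(2) mdl_nonneg next_mass_nonneg by simp
  qed
  finally show ?thesis .
qed

text \<open>Without outputs every likelihood is the empty product, so the mixture is the total
  weight 1.\<close>

lemma slack_0: "slack 0 \<le> 1"
proof -
  interpret D: prob_space D by (rule prob_space_data)
  have "slack 0 \<le> (\<integral>\<^sup>+y. 1 \<partial>D)"
    unfolding slack_def
    using nn_integral_w by (intro nn_integral_mono) (simp add: lik_def mixture_def)
  then show ?thesis by (simp add: D.emeasure_space_1)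
qed

text \<open>For \<open>M n y > 0\<close> this is the excess over 1 of the total mass of the dynamic
  predictor.\<close>

definition gain :: "nat \<Rightarrow> (nat \<Rightarrow> real) \<Rightarrow> real" where
  "gain n y = (next_mass n y - M n y) / M n y"

lemma gain_nonneg: "0 \<le> gain n y"
  unfolding gain_def using mdl_le_next_mass mdl_nonneg by simp

lemma measurable_gain [measurable]: "gain n \<in> borel_measurable Y"
  unfolding gain_def[abs_def] by measurable

lemma mdl_pos: "0 < L n y \<Longrightarrow> 0 < M n y"
  by (rule less_le_trans[OF mult_pos_pos[OF w_true] mdl_ge[OF true_model]])

text \<open>Summing \<open>slack_Suc\<close> from \<open>slack_0\<close> bounds the gains relative
  to the likelihood by 1; replacing \<open>L n y\<close> by \<open>M n y\<close> in the denominator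
  costs the factor \<open>1 / w \<mu>\<close>.\<close>

lemma sum_gain_le: "(\<Sum>n<T. \<integral>\<^sup>+y. ennreal (gain n y) \<partial>D) \<le> ennreal (1 / w \<mu>)"
proof -
  let ?G = "\<lambda>n. \<integral>\<^sup>+y. ennreal ((next_mass n y - M n y) / L n y) \<partial>D"
  \<comment> \<open>The remaining slack is carried through the induction and dropped only
    afterwards.\<close>
  have "slack T + (\<Sum>n<T. ?G n) \<le> 1"
  proof (induction T)
    case 0 show ?case using slack_0 by simp
  next
    case (Suc T)
    have "slack (Suc T) + (\<Sum>n<Suc T. ?G n) = (slack (Suc T) + ?G T) + (\<Sum>n<T. ?G n)"
      by (simp add: ac_simps)
    also have "\<dots> \<le> slack T + (\<Sum>n<T. ?G n)"
      by (intro add_right_mono slack_Suc)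
    finally show ?case using Suc by (rule order_trans)
  qed
  then have G: "(\<Sum>n<T. ?G n) \<le> 1"
    by (rule order_trans[rotated]) simp
  have "(\<integral>\<^sup>+y. ennreal (gain n y) \<partial>D) \<le> ennreal (1 / w \<mu>) * ?G n" for n
  proof -
    have "(\<integral>\<^sup>+y. ennreal (gain n y) \<partial>D)
        \<le> (\<integral>\<^sup>+y. ennreal (1 / w \<mu>) * ennreal ((next_mass n y - M n y) / L n y) \<partial>D)"
    proof (rule nn_integral_mono_AE, use AE_lik_pos in eventually_elim)
      fix y assume "\<forall>n. 0 < L n y"
      then have "0 < w \<mu> * L n y" using w_true by simp
      then have "gain n y \<le> (next_mass n y - M n y) / (w \<mu> * L n y)"
        unfolding gain_def using mdl_ge[OF true_model] mdl_le_next_mass[of n y]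
        by (intro divide_left_mono) (auto intro: less_le_trans intro!: mult_pos_pos simp del: mult_pos_pos)
      then show "ennreal (gain n y)
          \<le> ennreal (1 / w \<mu>) * ennreal ((next_mass n y - M n y) / L n y)"
        using w_true by (subst ennreal_mult'[symmetric]) (auto intro!: ennreal_leI)
    qed
    also have "\<dots> = ennreal (1 / w \<mu>) * ?G n"
      by (rule nn_integral_cmult) measurable
    finally show ?thesis .
  qed
  then have "(\<Sum>n<T. \<integral>\<^sup>+y. ennreal (gain n y) \<partial>D) \<le> (\<Sum>n<T. ennreal (1 / w \<mu>) * ?G n)"
    by (intro sum_mono)
  also have "\<dots> = ennreal (1 / w \<mu>) * (\<Sum>n<T. ?G n)"
    by (simp add: sum_distrib_left)
  also have "\<dots> \<le> ennreal (1 / w \<mu>) * 1"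
    using G by (intro mult_left_mono) auto
  finally show ?thesis by simp
qed

lemma suminf_gain_le: "(\<Sum>n. \<integral>\<^sup>+y. ennreal (gain n y) \<partial>D) \<le> ennreal (1 / w \<mu>)"
  by (intro suminf_le_const summableI sum_gain_le)

section \<open>Dynamic against normalized and static predictors\<close>

text \<open>Reduces (ii) and (iii) to a single history of positive likelihood; the other histories
  form a null set.\<close>

lemma hellinger2_le_gain:
  assumes "\<And>n y. \<forall>n. 0 < L n y \<Longrightarrow>
    (\<integral>\<^sup>+z. ennreal ((sqrt (\<phi> n x y z) - sqrt (\<psi> n x y z))\<^sup>2) \<partial>lborel) \<le> ennreal (gain n y)"
  shows "hellinger2 \<mu> x \<phi> \<psi> \<le> ennreal (1 / w \<mu>)"
  unfolding hellinger2_def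
proof (rule order_trans[OF suminf_le suminf_gain_le])
  fix n
  show "(\<integral>\<^sup>+y. (\<integral>\<^sup>+z. ennreal ((sqrt (\<phi> n x y z) - sqrt (\<psi> n x y z))\<^sup>2) \<partial>lborel) \<partial>D)
      \<le> (\<integral>\<^sup>+y. ennreal (gain n y) \<partial>D)"
    by (rule nn_integral_mono_AE, use AE_lik_pos in eventually_elim) (rule assms)
qed auto

text \<open>Both predictors are multiples of the same function of \<open>z\<close>, with factors
  \<open>1 / ?N\<close> and \<open>1 / ?m\<close>, so the distance is computed exactly as
  \<open>(sqrt ?N - sqrt ?m)\<^sup>2 / ?m\<close>.\<close>

lemma hellinger2_norm_dynamic:
  "hellinger2 \<mu> x (norm_dynamic_mdl C w) (dynamic_mdl C w) \<le> ennreal (1 / w \<mu>)"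
proof (rule hellinger2_le_gain)
  fix n y assume pos: "\<forall>n. 0 < L n y"
  let ?m = "M n y" and ?N = "next_mass n y"
  have m: "0 < ?m" using pos mdl_pos by blast
  have N: "0 < ?N" using m mdl_le_next_mass[of n y] by linarith
  let ?c = "(1 / sqrt ?N - 1 / sqrt ?m)\<^sup>2"
  have "(\<integral>\<^sup>+z. ennreal ((sqrt (norm_dynamic_mdl C w n x y z) - sqrt (dynamic_mdl C w n x y z))\<^sup>2) \<partial>lborel)
    = (\<integral>\<^sup>+z. ennreal ?c * ennreal (M (Suc n) (y(n := z))) \<partial>lborel)"
  proof (rule nn_integral_cong)
    fix z
    have "sqrt (norm_dynamic_mdl C w n x y z) - sqrt (dynamic_mdl C w n x y z)
      = (1 / sqrt ?N - 1 / sqrt ?m) * sqrt (M (Suc n) (y(n := z)))"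
      unfolding norm_dynamic_mdl_def dynamic_mdl_def next_mass_def[symmetric]
      by (simp add: real_sqrt_divide algebra_simps)
    then show "ennreal ((sqrt (norm_dynamic_mdl C w n x y z) - sqrt (dynamic_mdl C w n x y z))\<^sup>2)
      = ennreal ?c * ennreal (M (Suc n) (y(n := z)))"
      using mdl_nonneg by (simp add: power_mult_distrib ennreal_mult)
  qed
  also have "\<dots> = ennreal ?c * ennreal ?N"
    by (simp add: nn_integral_cmult nn_integral_mdl_Suc)
  also have "\<dots> = ennreal (?c * ?N)" using next_mass_nonneg by (rule ennreal_mult''[symmetric])
  also have "?c * ?N = (sqrt ?N - sqrt ?m)\<^sup>2 / ?m"
  proof -
    have "?c = (sqrt ?N - sqrt ?m)\<^sup>2 / ((sqrt ?N)\<^sup>2 * (sqrt ?m)\<^sup>2)"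
      using m N by (simp add: field_simps power2_eq_square)
    then show ?thesis using m N by simp
  qed
  also have "\<dots> \<le> gain n y"
    unfolding gain_def using m sqrt_diff_square_le[of ?m ?N] mdl_le_next_mass[of n y]
    by (intro divide_right_mono) auto
  finally show "(\<integral>\<^sup>+z. ennreal ((sqrt (norm_dynamic_mdl C w n x y z)
      - sqrt (dynamic_mdl C w n x y z))\<^sup>2) \<partial>lborel) \<le> ennreal (gain n y)"
    by (simp add: ennreal_leI)
qed

text \<open>The estimate attains \<open>M n y\<close> and competes in the next maximum, so the
  dynamic predictor dominates the static one pointwise. The difference of their masses is the
  gain.\<close>

lemma hellinger2_static:
  assumes est: "mdl_estimator C w est"
  shows "hellinger2 \<mu> x (dynamic_mdl C w) (static_mdl est) \<le> ennreal (1 / w \<mu>)"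
proof (rule hellinger2_le_gain)
  fix n y assume pos: "\<forall>n. 0 < L n y"
  let ?m = "M n y" and ?\<nu> = "est n x y"
  have m: "0 < ?m" using pos mdl_pos by blast
  have arg: "?\<nu> \<in> mdl_argmax C w n x y" using est by (simp add: mdl_estimator_def)
  then have \<nu>: "?\<nu> \<in> C" by (simp add: mdl_argmax_def)
  note [measurable] = model_measurable[OF \<nu>]
  have eq: "?m = w ?\<nu> * lik ?\<nu> n x y" by (rule mdl_eq_argmax[OF arg])
  have le: "?\<nu> (x n) z \<le> M (Suc n) (y(n := z)) / ?m" for z
    using mdl_ge[OF \<nu>, of "Suc n" "y(n := z)"] m
    by (simp add: lik_Suc mult.assoc[symmetric] eq[symmetric] pos_le_divide_eq mult.commute)
  have "(\<integral>\<^sup>+z. ennreal ((sqrt (dynamic_mdl C w n x y z) - sqrt (static_mdl est n x y z))\<^sup>2) \<partial>lborel)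
    \<le> (\<integral>\<^sup>+z. ennreal (1 / ?m) * ennreal (M (Suc n) (y(n := z))) - ennreal (?\<nu> (x n) z) \<partial>lborel)"
    unfolding dynamic_mdl_def static_mdl_def using model_bounds[OF \<nu>] m le
    by (intro nn_integral_mono)
      (auto simp: ennreal_mult'[symmetric] ennreal_minus intro!: ennreal_leI sqrt_diff_square_le)
  also have "\<dots> = ennreal (1 / ?m) * ennreal (next_mass n y) - 1"
  proof (subst nn_integral_diff)
    show "AE z in lborel. ennreal (?\<nu> (x n) z) \<le> ennreal (1 / ?m) * ennreal (M (Suc n) (y(n := z)))"
      using m le by (auto simp: ennreal_mult'[symmetric] intro!: ennreal_leI)
  qed (simp_all add: nn_integral_model[OF \<nu>] nn_integral_cmult nn_integral_mdl_Suc)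
  also have "\<dots> = ennreal (gain n y)"
    using m by (simp add: gain_def ennreal_mult'[symmetric] ennreal_minus
        diff_divide_distrib ennreal_1[symmetric] del: ennreal_1)
  finally show "(\<integral>\<^sup>+z. ennreal ((sqrt (dynamic_mdl C w n x y z) - sqrt (static_mdl est n x y z))\<^sup>2) \<partial>lborel)
    \<le> ennreal (gain n y)" .
qed

section \<open>True distribution against the normalized predictor\<close>

text \<open>The likelihood ratio of the normalized dynamic predictor to \<mu> at the realized output
  \<open>y n\<close>.\<close>

definition ratio :: "nat \<Rightarrow> (nat \<Rightarrow> real) \<Rightarrow> real" where
  "ratio n y = M (Suc n) y / next_mass n y / \<mu> (x n) (y n)"

lemma measurable_ratio [measurable]: "ratio n \<in> borel_measurable Y"
proof -
  have [measurable]: "(\<lambda>y. \<mu> (x n) (y n)) \<in> borel_measurable Y"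
    by (rule measurable_compose[where g = "\<mu> (x n)" and N = borel]) measurable
  show ?thesis unfolding ratio_def[abs_def] by measurable
qed

definition hell_step :: "nat \<Rightarrow> ennreal" where
  "hell_step n = (\<integral>\<^sup>+y. (\<integral>\<^sup>+z. ennreal ((sqrt (model_pred \<mu> n x y z)
     - sqrt (norm_dynamic_mdl C w n x y z))\<^sup>2) \<partial>lborel) \<partial>D)"

lemma norm_dynamic_eq: "norm_dynamic_mdl C w n x y z = M (Suc n) (y(n := z)) / next_mass n y"
  by (simp add: norm_dynamic_mdl_def next_mass_def)

lemma measurable_norm_dynamic [measurable]:
  "(\<lambda>(y, z). norm_dynamic_mdl C w n x y z) \<in> borel_measurable (Y \<Otimes>\<^sub>M borel)"
  unfolding norm_dynamic_eq by measurable

text \<open>Having both summands on the same side avoids any integrability question.\<close>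

lemma hell_step_plus:
  "hell_step n + (\<integral>\<^sup>+y. ennreal (2 * sqrt (ratio n y)) \<partial>D) \<le> 2"
proof -
  interpret D: prob_space D by (rule prob_space_data)
  let ?p = "\<lambda>z. \<mu> (x n) z" and ?q = "\<lambda>y z. norm_dynamic_mdl C w n x y z"
  have p0: "0 \<le> ?p z" for z using model_bounds[OF true_model] by simp
  have q0: "0 \<le> ?q y z" for y z
    by (simp add: norm_dynamic_eq mdl_nonneg next_mass_nonneg)
  have "(\<integral>\<^sup>+y. ennreal (2 * sqrt (ratio n y)) \<partial>D) =
    (\<integral>\<^sup>+y. (\<integral>\<^sup>+z. ennreal (?p z) * ennreal (2 * sqrt (ratio n (y(n := z)))) \<partial>lborel) \<partial>D)"
    by (rule nn_integral_data_upd) measurable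
  also have "\<dots> = (\<integral>\<^sup>+y. (\<integral>\<^sup>+z. ennreal (2 * sqrt (?p z * ?q y z)) \<partial>lborel) \<partial>D)"
  proof (intro nn_integral_cong)
    fix y z
    \<comment> \<open>Both sides vanish where \<open>?p z = 0\<close>.\<close>
    have "?p z * sqrt (?q y z / ?p z) = sqrt (?p z * ?q y z)"
      using p0[of z] by (cases "?p z = 0") (auto simp: real_sqrt_mult real_sqrt_divide real_div_sqrt field_simps)
    then have "?p z * (2 * sqrt (ratio n (y(n := z)))) = 2 * sqrt (?p z * ?q y z)"
      by (simp add: ratio_def norm_dynamic_eq)
    then show "ennreal (?p z) * ennreal (2 * sqrt (ratio n (y(n := z)))) = ennreal (2 * sqrt (?p z * ?q y z))"
      using p0[of z] by (simp only: ennreal_mult'[symmetric])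
  qed
  \<comment> \<open>This is twice the expected Hellinger affinity of the two predictors.\<close>
  finally have r: "(\<integral>\<^sup>+y. ennreal (2 * sqrt (ratio n y)) \<partial>D) =
    (\<integral>\<^sup>+y. (\<integral>\<^sup>+z. ennreal (2 * sqrt (?p z * ?q y z)) \<partial>lborel) \<partial>D)" .
  have q_meas [measurable]: "?q y \<in> borel_measurable borel" for y
    unfolding norm_dynamic_eq by measurable
  have "hell_step n + (\<integral>\<^sup>+y. ennreal (2 * sqrt (ratio n y)) \<partial>D)
    = (\<integral>\<^sup>+y. (\<integral>\<^sup>+z. ennreal ((sqrt (?p z) - sqrt (?q y z))\<^sup>2) \<partial>lborel)
        + (\<integral>\<^sup>+z. ennreal (2 * sqrt (?p z * ?q y z)) \<partial>lborel) \<partial>D)"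
    unfolding r hell_step_def model_pred_def by (rule nn_integral_add[symmetric]) measurable
  also have "\<dots> \<le> (\<integral>\<^sup>+y. 2 \<partial>D)"
  proof (rule nn_integral_mono)
    fix y
    have "(\<integral>\<^sup>+z. ennreal ((sqrt (?p z) - sqrt (?q y z))\<^sup>2) \<partial>lborel)
        + (\<integral>\<^sup>+z. ennreal (2 * sqrt (?p z * ?q y z)) \<partial>lborel)
      = (\<integral>\<^sup>+z. ennreal ((sqrt (?p z) - sqrt (?q y z))\<^sup>2) + ennreal (2 * sqrt (?p z * ?q y z)) \<partial>lborel)"
      by (rule nn_integral_add[symmetric]) measurable
    also have "\<dots> = (\<integral>\<^sup>+z. ennreal (?p z) + ennreal (?q y z) \<partial>lborel)"
    proof (rule nn_integral_cong)
      fix z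
      have "ennreal ((sqrt (?p z) - sqrt (?q y z))\<^sup>2) + ennreal (2 * sqrt (?p z * ?q y z))
        = ennreal ((sqrt (?p z) - sqrt (?q y z))\<^sup>2 + 2 * sqrt (?p z * ?q y z))"
        using p0[of z] q0[of y z] by (intro ennreal_plus[symmetric]) auto
      also have "(sqrt (?p z) - sqrt (?q y z))\<^sup>2 + 2 * sqrt (?p z * ?q y z) = ?p z + ?q y z"
        using p0[of z] q0[of y z] by (simp add: power2_diff real_sqrt_mult)
      also have "ennreal (?p z + ?q y z) = ennreal (?p z) + ennreal (?q y z)"
        using p0 q0 by (rule ennreal_plus)
      finally show "ennreal ((sqrt (?p z) - sqrt (?q y z))\<^sup>2) + ennreal (2 * sqrt (?p z * ?q y z))
        = ennreal (?p z) + ennreal (?q y z)" .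
    qed
    also have "\<dots> = 1 + (\<integral>\<^sup>+z. ennreal (?q y z) \<partial>lborel)"
      by (subst nn_integral_add) (auto simp: nn_integral_model[OF true_model])
    also have "(\<integral>\<^sup>+z. ennreal (?q y z) \<partial>lborel) =
      (\<integral>\<^sup>+z. ennreal (1 / next_mass n y) * ennreal (M (Suc n) (y(n := z))) \<partial>lborel)"
      using next_mass_nonneg[of n y]
      by (simp add: norm_dynamic_eq ennreal_mult'[symmetric])
    also have "\<dots> = ennreal (1 / next_mass n y) * ennreal (next_mass n y)"
      by (simp add: nn_integral_cmult nn_integral_mdl_Suc)
    \<comment> \<open>Equality unless \<open>next_mass n y = 0\<close>, where the quotient is 0 by
      convention.\<close>
    also have "\<dots> \<le> 1"
      using next_mass_nonneg[of n y] by (simp add: ennreal_mult'[symmetric])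
    finally show "(\<integral>\<^sup>+z. ennreal ((sqrt (?p z) - sqrt (?q y z))\<^sup>2) \<partial>lborel)
        + (\<integral>\<^sup>+z. ennreal (2 * sqrt (?p z * ?q y z)) \<partial>lborel) \<le> 2"
      by (simp add: add_left_mono)
  qed
  also have "\<dots> = 2" by (simp add: D.emeasure_space_1)
  finally show ?thesis .
qed

text \<open>Holds for each history: \<open>- ln (ratio n y)\<close> is the increment of
  \<open>ln (L n y / M n y)\<close> plus \<open>ln (next_mass n y / M n y)\<close>. The increments
  telescope and the last term is at most the gain.\<close>

lemma sum_ratio_ge:
  assumes pos: "\<forall>n. 0 < L n y"
  shows "2 * real T \<le> ln (1 / w \<mu>) + (\<Sum>n<T. gain n y) + (\<Sum>n<T. 2 * sqrt (ratio n y))"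
proof -
  have m: "0 < M n y" for n using pos mdl_pos by blast
  have N: "0 < next_mass n y" for n using m[of n] mdl_le_next_mass[of n y] by linarith
  have p: "0 < \<mu> (x n) (y n)" for n
    using pos model_bounds[OF true_model, of "x n" "y n"]
    by (metis lik_Suc less_le mult_zero_right)
  have step: "2 \<le> (ln (L (Suc n) y / M (Suc n) y) - ln (L n y / M n y)) + gain n y + 2 * sqrt (ratio n y)" for n
  proof -
    have r: "0 < ratio n y" using m N p by (simp add: ratio_def)
    \<comment> \<open>Taking the root before using \<open>ln z \<le> z - 1\<close> produces the
      affinity term.\<close>
    have "ln (sqrt (ratio n y)) \<le> sqrt (ratio n y) - 1"
      using r by (intro ln_le_minus_one) simp
    then have "2 \<le> 2 * sqrt (ratio n y) - ln (ratio n y)"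
      using r by (simp add: ln_sqrt)
    also have "ln (ratio n y) = ln (M (Suc n) y) - ln (next_mass n y) - ln (\<mu> (x n) (y n))"
      using m[of "Suc n"] N[of n] p[of n] by (simp add: ratio_def ln_div del: divide_divide_eq_left)
    also have "ln (next_mass n y) = ln (next_mass n y / M n y) + ln (M n y)"
      using m[of n] N[of n] by (simp add: ln_div)
    also have "ln (next_mass n y / M n y) \<le> next_mass n y / M n y - 1"
      using m N by (intro ln_le_minus_one) simp
    also have "next_mass n y / M n y - 1 = gain n y"
      using m[of n] by (simp add: gain_def diff_divide_distrib)
    finally show ?thesis
      using pos[rule_format, of n] m[of n] m[of "Suc n"] p[of n] by (simp add: ln_div lik_Suc ln_mult)
  qed
  have "2 * real T = (\<Sum>n<T. 2)" by simp
  also have "\<dots> \<le> (\<Sum>n<T. (ln (L (Suc n) y / M (Suc n) y) - ln (L n y / M n y)) + gain n y + 2 * sqrt (ratio n y))"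
    by (intro sum_mono step)
  also have "\<dots> = (ln (L T y / M T y) - ln (L 0 y / M 0 y)) + (\<Sum>n<T. gain n y) + (\<Sum>n<T. 2 * sqrt (ratio n y))"
    by (simp only: sum.distrib sum_lessThan_telescope[of "\<lambda>n. ln (L n y / M n y)"])
  \<comment> \<open>The final value is bounded through \<open>w \<mu> * L T y \<le> M T y\<close>;
    the initial one is nonnegative because \<open>M 0 y \<le> 1\<close>.\<close>
  also have "ln (L T y / M T y) - ln (L 0 y / M 0 y) \<le> ln (1 / w \<mu>)"
  proof -
    have "L T y / M T y \<le> 1 / w \<mu>"
      using mdl_ge[OF true_model, of T y] m[of T] w_true by (simp add: field_simps)
    then have "ln (L T y / M T y) \<le> ln (1 / w \<mu>)"
      using pos m[of T] w_true by (intro ln_mono divide_pos_pos) auto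
    moreover have "0 \<le> ln (L 0 y / M 0 y)"
      using mdl_0_le[of y] m[of 0] by (simp add: lik_def)
    ultimately show ?thesis by simp
  qed
  finally show ?thesis by simp
qed

text \<open>The expectation of \<open>sum_ratio_ge\<close> is compared with the sum of
  \<open>hell_step_plus\<close>; the affinity sums on both sides cancel.\<close>

lemma sum_hell_step_le: "(\<Sum>n<T. hell_step n) \<le> ennreal (1 / w \<mu> + ln (1 / w \<mu>))"
proof -
  interpret D: prob_space D by (rule prob_space_data)
  let ?b = "\<lambda>n. \<integral>\<^sup>+y. ennreal (2 * sqrt (ratio n y)) \<partial>D"
  let ?l = "ln (1 / w \<mu>)"
  have l: "0 \<le> ?l" using w_true w_le_1[OF true_model] by simp
  have r0: "0 \<le> ratio n y" for n y
    using model_bounds[OF true_model] mdl_nonneg next_mass_nonneg by (simp add: ratio_def)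
  have "(\<Sum>n<T. hell_step n) + (\<Sum>n<T. ?b n) \<le> (\<Sum>n<T. 2)"
    unfolding sum.distrib[symmetric] by (intro sum_mono hell_step_plus)
  also have "\<dots> = (\<integral>\<^sup>+y. ennreal (2 * real T) \<partial>D)"
    by (simp add: D.emeasure_space_1 ennreal_mult ennreal_of_nat_eq_real_of_nat mult.commute)
  also have "\<dots> \<le> (\<integral>\<^sup>+y. ennreal ?l + (\<Sum>n<T. ennreal (gain n y)) + (\<Sum>n<T. ennreal (2 * sqrt (ratio n y))) \<partial>D)"
  proof (rule nn_integral_mono_AE, use AE_lik_pos in eventually_elim)
    fix y assume "\<forall>n. 0 < L n y"
    then have "2 * real T \<le> ?l + (\<Sum>n<T. gain n y) + (\<Sum>n<T. 2 * sqrt (ratio n y))"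
      by (rule sum_ratio_ge)
    then have "ennreal (2 * real T) \<le> ennreal (?l + (\<Sum>n<T. gain n y) + (\<Sum>n<T. 2 * sqrt (ratio n y)))"
      by (rule ennreal_leI)
    then show "ennreal (2 * real T) \<le> ennreal ?l + (\<Sum>n<T. ennreal (gain n y)) + (\<Sum>n<T. ennreal (2 * sqrt (ratio n y)))"
      using l gain_nonneg r0 by (simp add: sum_nonneg)
  qed
  also have "\<dots> = ennreal ?l + (\<Sum>n<T. \<integral>\<^sup>+y. ennreal (gain n y) \<partial>D) + (\<Sum>n<T. ?b n)"
    by (simp add: nn_integral_add nn_integral_sum D.emeasure_space_1)
  finally have le: "(\<Sum>n<T. hell_step n) + (\<Sum>n<T. ?b n)
    \<le> ennreal ?l + (\<Sum>n<T. \<integral>\<^sup>+y. ennreal (gain n y) \<partial>D) + (\<Sum>n<T. ?b n)" .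
  \<comment> \<open>Cancellation in \<open>ennreal\<close> requires the common summand to be
    finite.\<close>
  have "?b n < top" for n
  proof -
    have "?b n \<le> 2"
      using hell_step_plus[of n] by (rule order_trans[rotated]) simp
    then show ?thesis by (rule le_less_trans) simp
  qed
  then have "(\<Sum>n<T. ?b n) \<noteq> top" by (simp add: less_top[symmetric])
  with le have "(\<Sum>n<T. hell_step n) \<le> ennreal ?l + (\<Sum>n<T. \<integral>\<^sup>+y. ennreal (gain n y) \<partial>D)"
    by (simp add: ennreal_add_left_cancel_le add.commute[of _ "\<Sum>n<T. ?b n"])
  also have "\<dots> \<le> ennreal ?l + ennreal (1 / w \<mu>)"
    by (intro add_left_mono sum_gain_le)
  also have "\<dots> = ennreal (1 / w \<mu> + ?l)"
    using l w_true by (simp add: ennreal_plus[symmetric] add.commute del: ennreal_plus)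
  finally show ?thesis .
qed

lemma hellinger2_true_norm:
  "hellinger2 \<mu> x (model_pred \<mu>) (norm_dynamic_mdl C w) \<le> ennreal (1 / w \<mu> + ln (1 / w \<mu>))"
  unfolding hellinger2_def hell_step_def[symmetric]
  by (intro suminf_le_const summableI sum_hell_step_le)

end

theorem theorem3:
  fixes C :: "('x \<Rightarrow> real \<Rightarrow> real) set"
    and w :: "('x \<Rightarrow> real \<Rightarrow> real) \<Rightarrow> real"
    and B :: real
    and \<mu> :: "'x \<Rightarrow> real \<Rightarrow> real"
    and est :: "nat \<Rightarrow> (nat \<Rightarrow> 'x) \<Rightarrow> (nat \<Rightarrow> real) \<Rightarrow> ('x \<Rightarrow> real \<Rightarrow> real)"
    and x :: "nat \<Rightarrow> 'x"
  assumes "countable C"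
    and "B > 0"
    and "\<And>\<nu> a. \<nu> \<in> C \<Longrightarrow> \<nu> a \<in> borel_measurable borel"
    and "\<And>\<nu> a b. \<nu> \<in> C \<Longrightarrow> 0 \<le> \<nu> a b \<and> \<nu> a b \<le> B"
    and "\<And>\<nu> a. \<nu> \<in> C \<Longrightarrow> (\<integral>b. \<nu> a b \<partial>lborel) = 1"
    and "\<And>\<nu>. \<nu> \<in> C \<Longrightarrow> w \<nu> > 0"
    and "(w has_sum 1) C"
    and "\<mu> \<in> C"
    and "mdl_estimator C w est"
  shows "hellinger2 \<mu> x (model_pred \<mu>) (norm_dynamic_mdl C w) \<le> ennreal (1 / w \<mu> + ln (1 / w \<mu>)) \<and>
    hellinger2 \<mu> x (norm_dynamic_mdl C w) (dynamic_mdl C w) \<le> ennreal (2 / w \<mu>) \<and>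
    hellinger2 \<mu> x (dynamic_mdl C w) (static_mdl est) \<le> ennreal (3 / w \<mu>)"
proof -
  interpret mdl_class C w B \<mu> x by unfold_locales fact+
  have "ennreal (1 / w \<mu>) \<le> ennreal (2 / w \<mu>)" "ennreal (1 / w \<mu>) \<le> ennreal (3 / w \<mu>)"
    using w_true by (auto intro!: ennreal_leI divide_right_mono)
  then show ?thesis
    using hellinger2_true_norm hellinger2_norm_dynamic hellinger2_static[OF assms(9)]
    by (auto intro: order_trans)
qed

end
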